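(* Let $\mathcal{A}^{(1)},\dots,\mathcal{A}^{(L)}\in\mathbb{C}^{n_1\times n_2\times\cdots\times n_d}$, $\alpha_1,\dots,\alpha_L\in\mathbb{R}^{+}$, $1\le r_i\le n_i$ for $1\le i\le d$, and let $(\cdot)^{\dagger}$ denote either $(\cdot)^{H}$ or $(\cdot)^{T}$. The function $$f(U^{(1)},\dots,U^{(d)})=\sum_{\ell=1}^{L}\alpha_\ell\|\mathcal{W}^{(\ell)}\|^2,\qquad \mathcal{W}^{(\ell)}=\mathcal{A}^{(\ell)}\bullet_1(U^{(1)})^{\dagger}\cdots\bullet_d(U^{(d)})^{\dagger},\qquad U^{(i)}\in\mathrm{St}(r_i,n_i,\mathbb{C}),$$ is restricted $\frac1\alpha$-homogeneous with $\alpha=\frac12$ and block multiconvex.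
   Context: $d>1$; $\mathrm{St}(r,n,\mathbb{C})=\{X\in\mathbb{C}^{n\times r}:X^{H}X=I_r\}$; $X^{T}$ and $X^{H}$ are transpose and conjugate transpose; $\mathbb{R}^{+}=[0,\infty)$. Mode product: for a tensor $\mathcal{A}\in\mathbb{C}^{n_1\times\cdots\times n_d}$ and $X\in\mathbb{C}^{m\times n_i}$, $(\mathcal{A}\bullet_iX)_{p_1\cdots q\cdots p_d}=\sum_{p_i}\mathcal{A}_{p_1\cdots p_i\cdots p_d}X_{qp_i}$ ($q$ in position $i$). $\|\cdot\|$ is the Frobenius norm of a tensor. $\langle X,Y\rangle_{\Re}=\Re\,\mathrm{tr}(X^{H}Y)$ is the real inner product on $\mathbb{C}^{n\times r}$ and $\nabla$ the Euclidean gradient with respect to it. For fixed $U^{(j)}\in\mathrm{St}(r_j,n_j,\mathbb{C})$, $j\ne i$, let $h_{(i)}(U)=f(U^{(1)},\dots,U^{(i-1)},U,U^{(i+1)},\dots,U^{(d)})$, extended to all $U\in\mathbb{C}^{n_i\times r_i}$ by the same formula. $f$ is restricted $\frac1\alpha$-homogeneous ($\alpha\in(0,1)$) if $h_{(i)}(U)=\alpha\langle U,\nabla h_{(i)}(U)\rangle_{\Re}$ for all $i$, all choices of the fixed blocks and all $U\in\mathrm{St}(r_i,n_i,\mathbb{C})$. $f$ is block multiconvex if $h_{(i)}$ is convex for all $i$ and all choices of the fixed blocks. *)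

theory Defs
  imports Complex_Main "Jordan_Normal_Form.Schur_Decomposition"
begin

definition mat_trace :: "'a::comm_monoid_add mat \<Rightarrow> 'a" where
  "mat_trace A = (\<Sum>i<dim_row A. A $$ (i, i))"

definition stiefel :: "nat \<Rightarrow> nat \<Rightarrow> complex mat set" where
  "stiefel r n = {X \<in> carrier_mat n r. mat_adjoint X * X = 1\<^sub>m r}"

definition rinner :: "complex mat \<Rightarrow> complex mat \<Rightarrow> real" where
  "rinner X Y = Re (mat_trace (mat_adjoint X * Y))"

definition fnorm :: "complex mat \<Rightarrow> real" where
  "fnorm X = sqrt (rinner X X)"

text \<open>The type of matrices of all sizes is not a normed space, so the library's \<open>has_derivative\<close>
  and \<open>convex_on\<close> do not apply; the following definitions spell out the Frechet gradient
  and convexity on the real vector space of complex matrices with \<open>n\<close> rows and \<open>r\<close> columns.\<close>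

definition has_gradient ::
  "nat \<Rightarrow> nat \<Rightarrow> (complex mat \<Rightarrow> real) \<Rightarrow> complex mat \<Rightarrow> complex mat \<Rightarrow> bool" where
  "has_gradient n r h X G \<longleftrightarrow> G \<in> carrier_mat n r \<and>
     (\<forall>\<epsilon>>0. \<exists>\<delta>>0. \<forall>H\<in>carrier_mat n r.
        fnorm H < \<delta> \<longrightarrow> \<bar>h (X + H) - h X - rinner G H\<bar> \<le> \<epsilon> * fnorm H)"

definition gradient :: "nat \<Rightarrow> nat \<Rightarrow> (complex mat \<Rightarrow> real) \<Rightarrow> complex mat \<Rightarrow> complex mat" where
  "gradient n r h X = (THE G. has_gradient n r h X G)"

definition convex_on_mat :: "nat \<Rightarrow> nat \<Rightarrow> (complex mat \<Rightarrow> real) \<Rightarrow> bool" where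
  "convex_on_mat n r h \<longleftrightarrow>
     (\<forall>X\<in>carrier_mat n r. \<forall>Y\<in>carrier_mat n r. \<forall>t::real. 0 \<le> t \<and> t \<le> 1 \<longrightarrow>
        h (complex_of_real (1 - t) \<cdot>\<^sub>m X + complex_of_real t \<cdot>\<^sub>m Y) \<le> (1 - t) * h X + t * h Y)"

lemma rinner_sum:
  assumes "X \<in> carrier_mat n r" "Y \<in> carrier_mat n r"
  shows "rinner X Y = (\<Sum>j<r. \<Sum>k<n. Re (cnj (X $$ (k, j)) * Y $$ (k, j)))"
  using assms
  by (auto simp: rinner_def mat_trace_def mat_adjoint_def scalar_prod_def mat_of_rows_def
      lessThan_atLeast0 intro!: sum.cong)

lemma rinner_self:
  assumes "X \<in> carrier_mat n r"
  shows "rinner X X = (\<Sum>j<r. \<Sum>k<n. (cmod (X $$ (k, j)))\<^sup>2)"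
  unfolding rinner_sum[OF assms assms]
  by (intro sum.cong refl) (simp add: cmod_power2, simp add: power2_eq_square)

text \<open>The gradient is unique, so the definite description above is well defined whenever
  the function is differentiable.\<close>

lemma has_gradient_unique:
  assumes G: "has_gradient n r h X G" and G': "has_gradient n r h X G'"
  shows "G = G'"
proof -
  have cG: "G \<in> carrier_mat n r" and cG': "G' \<in> carrier_mat n r"
    using G G' by (auto simp: has_gradient_def)
  define D where "D = G - G'"
  have cD: "D \<in> carrier_mat n r" unfolding D_def using cG cG' by auto
  define s where "s = rinner D D"
  have s0: "s \<ge> 0" unfolding s_def rinner_self[OF cD] by (intro sum_nonneg) auto
  have "s = 0"
  proof (rule ccontr)
    assume "s \<noteq> 0"
    hence spos: "s > 0" using s0 by simp
    define e where "e = sqrt s / 4"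
    have epos: "e > 0" using spos by (simp add: e_def)
    obtain d where d: "d > 0"
      "\<And>H. H \<in> carrier_mat n r \<Longrightarrow> fnorm H < d \<Longrightarrow> \<bar>h (X + H) - h X - rinner G H\<bar> \<le> e * fnorm H"
      using G epos unfolding has_gradient_def by blast
    obtain d' where d': "d' > 0"
      "\<And>H. H \<in> carrier_mat n r \<Longrightarrow> fnorm H < d' \<Longrightarrow> \<bar>h (X + H) - h X - rinner G' H\<bar> \<le> e * fnorm H"
      using G' epos unfolding has_gradient_def by blast
    define t where "t = min d d' / (2 * sqrt s)"
    have tpos: "t > 0" using d d' spos by (simp add: t_def)
    define H where "H = complex_of_real t \<cdot>\<^sub>m D"
    have cH: "H \<in> carrier_mat n r" using cD by (simp add: H_def)
    have ent: "H $$ (k, j) = complex_of_real t * D $$ (k, j)" if "k < n" "j < r" for k j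
      using that cD by (simp add: H_def)
    have "rinner H H = t\<^sup>2 * s"
      unfolding s_def rinner_self[OF cD] rinner_self[OF cH] sum_distrib_left
      by (intro sum.cong refl) (simp add: ent norm_mult power_mult_distrib)
    hence nH: "fnorm H = t * sqrt s"
      using tpos by (simp add: fnorm_def real_sqrt_mult)
    have "t * sqrt s = min d d' / 2" using spos by (simp add: t_def)
    hence small: "fnorm H < d" "fnorm H < d'" using nH d(1) d'(1) by linarith+
    have "rinner G H - rinner G' H = t * s"
      unfolding s_def rinner_sum[OF cG cH] rinner_sum[OF cG' cH] rinner_sum[OF cD cD]
        sum_subtractf[symmetric] sum_distrib_left
      using cG cG'
      by (intro sum.cong refl) (simp add: ent D_def algebra_simps)
    moreover have "\<bar>rinner G H - rinner G' H\<bar> \<le> 2 * e * fnorm H"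
      using d(2)[OF cH small(1)] d'(2)[OF cH small(2)] by linarith
    ultimately have "t * s \<le> 2 * e * (t * sqrt s)" unfolding nH by (metis abs_le_D1)
    also have "\<dots> = t * s / 2" using spos by (simp add: e_def)
    finally show False using tpos spos by simp
  qed
  hence "(\<Sum>j<r. \<Sum>k<n. (cmod (D $$ (k, j)))\<^sup>2) = 0"
    using s_def rinner_self[OF cD] by simp
  hence "D $$ (k, j) = 0" if "k < n" "j < r" for k j
    using that by (simp add: sum_nonneg_eq_0_iff sum_nonneg)
  thus ?thesis using cG cG' by (intro eq_matI) (auto simp: D_def)
qed

lemma gradient_eq: "has_gradient n r h X G \<Longrightarrow> gradient n r h X = G"
  unfolding gradient_def using has_gradient_unique by blast

text \<open>A tensor carries its list of dimensions. Modes and indices are counted from \<open>0\<close>; the values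
  of \<open>entry\<close> outside \<open>multi_indices (dims A)\<close> are irrelevant.\<close>

datatype ctensor = Tensor (dims: "nat list") (entry: "nat list \<Rightarrow> complex")

definition multi_indices :: "nat list \<Rightarrow> nat list set" where
  "multi_indices ns = {p. length p = length ns \<and> (\<forall>i<length ns. p ! i < ns ! i)}"

definition tnorm :: "ctensor \<Rightarrow> real" where
  "tnorm A = sqrt (\<Sum>p\<in>multi_indices (dims A). (cmod (entry A p))\<^sup>2)"

definition mode_prod :: "ctensor \<Rightarrow> nat \<Rightarrow> complex mat \<Rightarrow> ctensor" where
  "mode_prod A i X = Tensor ((dims A)[i := dim_row X])
     (\<lambda>p. \<Sum>k<dims A ! i. entry A (p[i := k]) * X $$ (p ! i, k))"

definition multi_mode_prod :: "ctensor \<Rightarrow> complex mat list \<Rightarrow> ctensor" where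
  "multi_mode_prod A Xs = fold (\<lambda>i B. mode_prod B i (Xs ! i)) [0..<length Xs] A"

text \<open>\<open>block f Us i\<close> is the partial function in block \<open>i\<close>, defined on all matrices; the entry
  \<open>Us ! i\<close> is overwritten, so only the other blocks are constrained by \<open>stiefel_blocks_except\<close>.\<close>

definition block :: "(complex mat list \<Rightarrow> real) \<Rightarrow> complex mat list \<Rightarrow> nat \<Rightarrow> complex mat \<Rightarrow> real" where
  "block f Us i = (\<lambda>V. f (Us[i := V]))"

definition stiefel_blocks_except :: "nat list \<Rightarrow> nat list \<Rightarrow> nat \<Rightarrow> complex mat list \<Rightarrow> bool" where
  "stiefel_blocks_except rs ns i Us \<longleftrightarrow> length Us = length ns \<and>
     (\<forall>j<length ns. j \<noteq> i \<longrightarrow> Us ! j \<in> stiefel (rs ! j) (ns ! j))"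

text \<open>The parameter \<open>\<alpha>\<close> is the reciprocal of the degree of homogeneity.\<close>

definition restricted_homogeneous ::
  "nat list \<Rightarrow> nat list \<Rightarrow> real \<Rightarrow> (complex mat list \<Rightarrow> real) \<Rightarrow> bool" where
  "restricted_homogeneous rs ns \<alpha> f \<longleftrightarrow> 0 < \<alpha> \<and> \<alpha> < 1 \<and>
     (\<forall>i<length ns. \<forall>Us. stiefel_blocks_except rs ns i Us \<longrightarrow>
        (\<forall>U\<in>stiefel (rs ! i) (ns ! i).
           (\<exists>G. has_gradient (ns ! i) (rs ! i) (block f Us i) U G) \<and>
           block f Us i U = \<alpha> * rinner U (gradient (ns ! i) (rs ! i) (block f Us i) U)))"

definition block_multiconvex ::
  "nat list \<Rightarrow> nat list \<Rightarrow> (complex mat list \<Rightarrow> real) \<Rightarrow> bool" where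
  "block_multiconvex rs ns f \<longleftrightarrow>
     (\<forall>i<length ns. \<forall>Us. stiefel_blocks_except rs ns i Us \<longrightarrow>
        convex_on_mat (ns ! i) (rs ! i) (block f Us i))"

definition tucker_objective ::
  "(complex mat \<Rightarrow> complex mat) \<Rightarrow> nat \<Rightarrow> (nat \<Rightarrow> real) \<Rightarrow> (nat \<Rightarrow> ctensor) \<Rightarrow>
     complex mat list \<Rightarrow> real" where
  "tucker_objective dag L a A Us =
     (\<Sum>l=1..L. a l * (tnorm (multi_mode_prod (A l) (map dag Us)))\<^sup>2)"

end

theory Submission
  imports Defs
begin

text \<open>Every entry of the multilinear product is linear, or conjugate-linear, in each single
  factor. With all blocks but one fixed, the objective is therefore a sum of terms
  \<open>w * \<bar>T V\<bar>\<^sup>2\<close> with \<open>w \<ge> 0\<close> and \<open>T\<close> real-linear in the free block \<open>V\<close>, that is, a positive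
  semidefinite real quadratic form. Such a form is convex, and it expands as
  \<open>h (X + H) = h X + 2 * (\<Sum>w * Re (cnj (T X) * T H)) + h H\<close> with \<open>h H = O(\<parallel>H\<parallel>\<^sup>2)\<close>. The linear
  term is the pairing of \<open>H\<close> with the gradient; at \<open>H = X\<close> it equals \<open>2 * h X\<close>, which is
  Euler's identity of degree two.

  Two facts carry the proof: \<open>sum_cmod_real_form_has_gradient\<close>, the analytic statement on such
  quadratic forms, and \<open>real_linear_family_mode_prod\<close>, by which mode products along the other
  modes preserve real-linear dependence on \<open>V\<close>.\<close>

section \<open>Real-linear functionals of a complex matrix\<close>

text \<open>This is the general real-linear functional with complex values. Allowing both \<open>V\<close> and its
  conjugate treats the transpose and the adjoint at once.\<close>

definition real_form ::
  "nat \<Rightarrow> nat \<Rightarrow> (nat \<Rightarrow> nat \<Rightarrow> complex) \<Rightarrow> (nat \<Rightarrow> nat \<Rightarrow> complex) \<Rightarrow> complex mat \<Rightarrow> complex" where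
  "real_form n r b c V = (\<Sum>j<r. \<Sum>k<n. b k j * V $$ (k, j) + c k j * cnj (V $$ (k, j)))"

lemma real_form_add:
  assumes "X \<in> carrier_mat n r" "Y \<in> carrier_mat n r"
  shows "real_form n r b c (X + Y) = real_form n r b c X + real_form n r b c Y"
  using assms unfolding real_form_def sum.distrib[symmetric]
  by (intro sum.cong refl) (simp add: algebra_simps)

lemma real_form_scale:
  assumes "X \<in> carrier_mat n r"
  shows "real_form n r b c (complex_of_real t \<cdot>\<^sub>m X) = complex_of_real t * real_form n r b c X"
  using assms unfolding real_form_def sum_distrib_left
  by (intro sum.cong refl) (simp add: algebra_simps)

lemma real_form_sum_coeffs:
  assumes "finite Q"
  shows "(\<Sum>q\<in>Q. real_form n r (b q) (c q) V * x q)
    = real_form n r (\<lambda>k j. \<Sum>q\<in>Q. b q k j * x q) (\<lambda>k j. \<Sum>q\<in>Q. c q k j * x q) V"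
  using assms
proof (induction Q)
  case empty
  then show ?case by (simp add: real_form_def)
next
  case (insert q Q)
  have "real_form n r (b q) (c q) V * x q + real_form n r B C V
      = real_form n r (\<lambda>k j. b q k j * x q + B k j) (\<lambda>k j. c q k j * x q + C k j) V" for B C
    unfolding real_form_def sum_distrib_right sum.distrib[symmetric]
    by (intro sum.cong refl) (simp add: algebra_simps)
  with insert show ?case by simp
qed

lemma cmod_entry_le_fnorm:
  assumes "H \<in> carrier_mat n r" "k < n" "j < r"
  shows "cmod (H $$ (k, j)) \<le> fnorm H"
proof -
  have "(cmod (H $$ (k, j)))\<^sup>2 \<le> (\<Sum>k<n. (cmod (H $$ (k, j)))\<^sup>2)"
    using assms(2) by (intro member_le_sum) auto
  also have "\<dots> \<le> (\<Sum>j<r. \<Sum>k<n. (cmod (H $$ (k, j)))\<^sup>2)"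
    using assms(3) by (intro member_le_sum[where f = "\<lambda>j. \<Sum>k<n. (cmod (H $$ (k, j)))\<^sup>2"])
      (auto intro: sum_nonneg)
  finally show ?thesis
    unfolding fnorm_def rinner_self[OF assms(1)] by (rule real_le_rsqrt)
qed

lemma cmod_real_form_le:
  assumes H: "H \<in> carrier_mat n r"
  shows "cmod (real_form n r b c H) \<le> (\<Sum>j<r. \<Sum>k<n. cmod (b k j) + cmod (c k j)) * fnorm H"
  unfolding real_form_def sum_distrib_right
proof (intro sum_norm_le)
  fix j k assume jk: "j \<in> {..<r}" "k \<in> {..<n}"
  have "cmod (b k j * H $$ (k, j) + c k j * cnj (H $$ (k, j)))
      \<le> (cmod (b k j) + cmod (c k j)) * cmod (H $$ (k, j))"
    by (rule order_trans[OF norm_triangle_ineq]) (simp add: norm_mult algebra_simps)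
  also have "\<dots> \<le> (cmod (b k j) + cmod (c k j)) * fnorm H"
    using cmod_entry_le_fnorm[OF H] jk by (intro mult_left_mono) auto
  finally show "cmod (b k j * H $$ (k, j) + c k j * cnj (H $$ (k, j)))
      \<le> (cmod (b k j) + cmod (c k j)) * fnorm H" .
qed

section \<open>Sums of squared moduli of real-linear functionals\<close>

lemma rinner_commute:
  assumes "X \<in> carrier_mat n r" "Y \<in> carrier_mat n r"
  shows "rinner X Y = rinner Y X"
  unfolding rinner_sum[OF assms] rinner_sum[OF assms(2,1)]
  by (intro sum.cong refl) (simp add: algebra_simps)

text \<open>Riesz representation. With \<open>z x\<close> the value of the \<open>x\<close>-th functional at a point, the right-hand
  side is the differential there of the weighted sum of squared moduli. Since
  \<open>Re (u * cnj v) = Re (cnj u * v)\<close>, a coefficient of \<open>cnj H\<close> can be moved onto \<open>H\<close>, and the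
  representing matrix can be read off entrywise.\<close>

lemma differential_representation:
  fixes b c :: "'x \<Rightarrow> nat \<Rightarrow> nat \<Rightarrow> complex" and w :: "'x \<Rightarrow> real" and z :: "'x \<Rightarrow> complex"
  shows "\<exists>G\<in>carrier_mat n r. \<forall>H\<in>carrier_mat n r.
    rinner G H = 2 * (\<Sum>x\<in>S. w x * Re (cnj (z x) * real_form n r (b x) (c x) H))"
proof -
  define g where
    "g k j = 2 * (\<Sum>x\<in>S. complex_of_real (w x) * (z x * cnj (b x k j) + cnj (z x) * c x k j))"
    for k j
  define G where "G = mat n r (\<lambda>(k, j). g k j)"
  have G: "G \<in> carrier_mat n r" by (simp add: G_def)
  have "rinner G H = 2 * (\<Sum>x\<in>S. w x * Re (cnj (z x) * real_form n r (b x) (c x) H))"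
    if H: "H \<in> carrier_mat n r" for H
  proof -
    have entrywise: "Re (cnj (G $$ (k, j)) * H $$ (k, j))
      = (\<Sum>x\<in>S. 2 * w x * Re (cnj (z x) *
          (b x k j * H $$ (k, j) + c x k j * cnj (H $$ (k, j)))))"
      if "j < r" "k < n" for j k
    proof -
      have eq: "cnj (G $$ (k, j)) * H $$ (k, j) = (\<Sum>x\<in>S. 2 * complex_of_real (w x) *
          ((cnj (z x) * b x k j + z x * cnj (c x k j)) * H $$ (k, j)))"
        using that by (simp add: G_def g_def sum_distrib_left sum_distrib_right algebra_simps)
      show ?thesis
        unfolding eq Re_sum by (intro sum.cong refl) (simp add: algebra_simps)
    qed
    have "rinner G H = (\<Sum>j<r. \<Sum>k<n. \<Sum>x\<in>S. 2 * w x * Re (cnj (z x) *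
          (b x k j * H $$ (k, j) + c x k j * cnj (H $$ (k, j)))))"
      unfolding rinner_sum[OF G H] by (intro sum.cong refl entrywise) auto
    also have "\<dots> = (\<Sum>j<r. \<Sum>x\<in>S. \<Sum>k<n. 2 * w x * Re (cnj (z x) *
          (b x k j * H $$ (k, j) + c x k j * cnj (H $$ (k, j)))))"
      by (intro sum.cong refl sum.swap)
    also have "\<dots> = (\<Sum>x\<in>S. \<Sum>j<r. \<Sum>k<n. 2 * w x * Re (cnj (z x) *
          (b x k j * H $$ (k, j) + c x k j * cnj (H $$ (k, j)))))"
      by (rule sum.swap)
    also have "\<dots> = 2 * (\<Sum>x\<in>S. w x * Re (cnj (z x) * real_form n r (b x) (c x) H))"
      unfolding real_form_def sum_distrib_left Re_sum
      by (intro sum.cong refl) (simp only: mult.assoc)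
    finally show ?thesis .
  qed
  with G show ?thesis by blast
qed

lemma cmod_add_square:
  "(cmod (u + v))\<^sup>2 = (cmod u)\<^sup>2 + 2 * Re (cnj u * v) + (cmod v)\<^sup>2"
  by (simp only: cmod_power2 plus_complex.simps times_complex.simps complex_cnj)
    (simp add: power2_eq_square algebra_simps)

text \<open>Expanding the squares leaves a quadratic remainder \<open>\<le> K * \<parallel>H\<parallel>\<^sup>2\<close>, so the differential is
  the cross term. Evaluated in the direction \<open>X\<close> itself it gives twice the value, and this is
  Euler's identity.\<close>

lemma sum_cmod_real_form_has_gradient:
  assumes h: "\<And>V. V \<in> carrier_mat n r \<Longrightarrow>
      h V = (\<Sum>x\<in>S. w x * (cmod (real_form n r (b x) (c x) V))\<^sup>2)"
    and w: "\<And>x. x \<in> S \<Longrightarrow> 0 \<le> w x"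
    and X: "X \<in> carrier_mat n r"
  obtains G where "has_gradient n r h X G" "h X = 1/2 * rinner X G"
proof -
  define T where "T x = real_form n r (b x) (c x)" for x
  obtain G where G: "G \<in> carrier_mat n r"
    and pair: "\<And>H. H \<in> carrier_mat n r \<Longrightarrow>
      rinner G H = 2 * (\<Sum>x\<in>S. w x * Re (cnj (T x X) * T x H))"
    using differential_representation[where n = n and r = r and S = S and w = w
        and z = "\<lambda>x. T x X" and b = b and c = c]
    unfolding T_def by blast
  define M where "M x = (\<Sum>j<r. \<Sum>k<n. cmod (b x k j) + cmod (c x k j))" for x
  define K where "K = (\<Sum>x\<in>S. w x * (M x)\<^sup>2)"
  have K: "0 \<le> K" unfolding K_def by (intro sum_nonneg) (simp add: w)
  have remainder: "h (X + H) - h X - rinner G H = h H" if H: "H \<in> carrier_mat n r" for H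
  proof -
    have "h (X + H) = (\<Sum>x\<in>S. w x * (cmod (T x X + T x H))\<^sup>2)"
      using X H by (simp add: h T_def real_form_add)
    also have "\<dots> = (\<Sum>x\<in>S. w x * (cmod (T x X))\<^sup>2)
        + 2 * (\<Sum>x\<in>S. w x * Re (cnj (T x X) * T x H)) + (\<Sum>x\<in>S. w x * (cmod (T x H))\<^sup>2)"
      unfolding sum_distrib_left sum.distrib[symmetric] cmod_add_square
      by (intro sum.cong refl) (simp only: algebra_simps)
    also have "\<dots> = h X + rinner G H + h H"
      using X H by (simp only: h pair T_def)
    finally show ?thesis by simp
  qed
  have bound: "\<bar>h H\<bar> \<le> K * (fnorm H)\<^sup>2" if H: "H \<in> carrier_mat n r" for H
  proof -
    have "0 \<le> h H" using H by (simp add: h w sum_nonneg)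
    moreover have "h H \<le> (\<Sum>x\<in>S. w x * (M x * fnorm H)\<^sup>2)"
      unfolding h[OF H] M_def
      by (intro sum_mono mult_left_mono power_mono cmod_real_form_le H w norm_ge_zero)
    ultimately show ?thesis by (simp add: K_def sum_distrib_right power_mult_distrib mult.assoc)
  qed
  have "has_gradient n r h X G"
    unfolding has_gradient_def
  proof (intro conjI G allI impI)
    fix \<epsilon> :: real assume \<epsilon>: "0 < \<epsilon>"
    show "\<exists>\<delta>>0. \<forall>H\<in>carrier_mat n r. fnorm H < \<delta> \<longrightarrow>
        \<bar>h (X + H) - h X - rinner G H\<bar> \<le> \<epsilon> * fnorm H"
      \<comment> \<open>The quotient \<open>\<epsilon> / K\<close> would do, but \<open>K\<close> can be \<open>0\<close>.\<close>
    proof (intro exI[of _ "\<epsilon> / (K + 1)"] conjI ballI impI)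
      show "0 < \<epsilon> / (K + 1)" using \<epsilon> K by simp
      fix H assume H: "H \<in> carrier_mat n r" and small: "fnorm H < \<epsilon> / (K + 1)"
      have H0: "0 \<le> fnorm H"
        unfolding fnorm_def rinner_self[OF H] by (intro real_sqrt_ge_zero sum_nonneg) simp
      have "fnorm H * (K + 1) < \<epsilon>" using small K by (simp add: pos_less_divide_eq)
      then have "K * fnorm H \<le> \<epsilon>" using H0 by (simp add: algebra_simps)
      then have "K * fnorm H * fnorm H \<le> \<epsilon> * fnorm H" using H0 by (rule mult_right_mono)
      then show "\<bar>h (X + H) - h X - rinner G H\<bar> \<le> \<epsilon> * fnorm H"
        using bound[OF H] remainder[OF H] by (simp add: power2_eq_square mult.assoc)
    qed
  qed
  moreover have "h X = 1/2 * rinner X G"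
  proof -
    have "Re (cnj u * u) = (cmod u)\<^sup>2" for u
      by (simp only: cmod_power2) (simp add: power2_eq_square)
    then show ?thesis using X by (simp add: rinner_commute[OF X G] pair h T_def)
  qed
  ultimately show thesis by (rule that)
qed

lemma cmod_square_convex:
  assumes "0 \<le> t" "t \<le> 1"
  shows "(cmod (complex_of_real (1 - t) * u + complex_of_real t * v))\<^sup>2
    \<le> (1 - t) * (cmod u)\<^sup>2 + t * (cmod v)\<^sup>2"
proof -
  have "(1 - t) * (cmod u)\<^sup>2 + t * (cmod v)\<^sup>2
      - (cmod (complex_of_real (1 - t) * u + complex_of_real t * v))\<^sup>2
      = t * (1 - t) * (cmod (u - v))\<^sup>2"
    by (simp only: cmod_power2) (simp add: power2_eq_square algebra_simps)
  also have "\<dots> \<ge> 0" using assms by simp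
  finally show ?thesis by simp
qed

lemma sum_cmod_real_form_convex:
  assumes h: "\<And>V. V \<in> carrier_mat n r \<Longrightarrow>
      h V = (\<Sum>x\<in>S. w x * (cmod (real_form n r (b x) (c x) V))\<^sup>2)"
    and w: "\<And>x. x \<in> S \<Longrightarrow> 0 \<le> w x"
  shows "convex_on_mat n r h"
  unfolding convex_on_mat_def
proof (intro ballI allI impI)
  fix X Y :: "complex mat" and t :: real
  assume X: "X \<in> carrier_mat n r" and Y: "Y \<in> carrier_mat n r" and t: "0 \<le> t \<and> t \<le> 1"
  define T where "T x = real_form n r (b x) (c x)" for x
  have "h (complex_of_real (1 - t) \<cdot>\<^sub>m X + complex_of_real t \<cdot>\<^sub>m Y)
      = (\<Sum>x\<in>S. w x * (cmod (complex_of_real (1 - t) * T x X + complex_of_real t * T x Y))\<^sup>2)"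
    using X Y by (simp add: h T_def real_form_add real_form_scale del: of_real_diff)
  also have "\<dots> \<le> (\<Sum>x\<in>S. w x * ((1 - t) * (cmod (T x X))\<^sup>2 + t * (cmod (T x Y))\<^sup>2))"
    using t by (intro sum_mono mult_left_mono cmod_square_convex w) auto
  also have "\<dots> = (1 - t) * h X + t * h Y"
    unfolding h[OF X] h[OF Y] T_def sum_distrib_left sum.distrib[symmetric]
    by (intro sum.cong refl) (simp only: algebra_simps)
  finally show "h (complex_of_real (1 - t) \<cdot>\<^sub>m X + complex_of_real t \<cdot>\<^sub>m Y)
      \<le> (1 - t) * h X + t * h Y" .
qed

section \<open>Tensors depending real-linearly on one factor\<close>

lemma finite_multi_indices: "finite (multi_indices ns)"
proof (rule finite_subset)
  show "multi_indices ns \<subseteq> {p. set p \<subseteq> {..sum_list ns} \<and> length p = length ns}"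
  proof (intro subsetI CollectI conjI)
    fix p m assume p: "p \<in> multi_indices ns" and "m \<in> set p"
    then obtain i where "i < length ns" "m = p ! i"
      by (auto simp: multi_indices_def in_set_conv_nth)
    then show "m \<in> {..sum_list ns}"
      using p elem_le_sum_list[of i ns] by (fastforce simp: multi_indices_def)
  qed (simp add: multi_indices_def)
  show "finite {p. set p \<subseteq> {..sum_list ns} \<and> length p = length ns}"
    by (rule finite_lists_length_eq) simp
qed

text \<open>Entries are controlled only at positions \<open>p\<close> with \<open>p ! i < r\<close>, because beyond that bound
  they would refer to matrix entries outside \<open>V\<close>. A mode product along another mode leaves
  \<open>p ! i\<close> unchanged, so this restriction is stable.\<close>

definition real_linear_family ::
  "nat \<Rightarrow> nat \<Rightarrow> nat \<Rightarrow> (complex mat \<Rightarrow> ctensor) \<Rightarrow> bool" where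
  "real_linear_family n r i F \<longleftrightarrow> (\<exists>D b c. i < length D \<and> D ! i = r \<and>
     (\<forall>V\<in>carrier_mat n r. dims (F V) = D \<and>
        (\<forall>p. p ! i < r \<longrightarrow> entry (F V) p = real_form n r (b p) (c p) V)))"

text \<open>The entry of the product at \<open>p\<close> involves only column \<open>p ! i\<close> of \<open>V\<close> (conjugated for the adjoint), so the
  coefficients are those of \<open>B\<close>, extended by \<open>0\<close> to the other columns.\<close>

lemma real_linear_family_start:
  assumes dag: "dag = mat_adjoint \<or> dag = transpose_mat"
    and i: "i < length (dims B)" and n: "dims B ! i = n"
  shows "real_linear_family n r i (\<lambda>V. mode_prod B i (dag V))"
proof -
  define e where "e p k j = (if j = p ! i then entry B (p[i := k]) else 0)" for p k j
  have column: "(\<Sum>j<r. \<Sum>k<n. e p k j * y k j) = (\<Sum>k<n. entry B (p[i := k]) * y k (p ! i))"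
    if "p ! i < r" for p and y :: "nat \<Rightarrow> nat \<Rightarrow> complex"
  proof -
    have "(\<Sum>j<r. \<Sum>k<n. e p k j * y k j)
        = (\<Sum>j<r. if j = p ! i then \<Sum>k<n. entry B (p[i := k]) * y k j else 0)"
      by (intro sum.cong refl) (simp add: e_def)
    then show ?thesis using that by (simp add: sum.delta)
  qed
  from dag show ?thesis
  proof
    assume dag: "dag = mat_adjoint"
    have "entry (mode_prod B i (dag V)) p = real_form n r (\<lambda>_ _. 0) (e p) V"
      if V: "V \<in> carrier_mat n r" and p: "p ! i < r" for V p
      using V p column[OF p, of "\<lambda>k j. cnj (V $$ (k, j))"]
      by (simp add: mode_prod_def real_form_def dag n mat_adjoint_def mat_of_rows_def)
    moreover have "dims (mode_prod B i (dag V)) = (dims B)[i := r]"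
      if "V \<in> carrier_mat n r" for V
      using that by (simp add: mode_prod_def dag mat_adjoint_def)
    ultimately show ?thesis
      unfolding real_linear_family_def using i
      by (intro exI[of _ "(dims B)[i := r]"] exI[of _ "\<lambda>_ _ _. 0"] exI[of _ e]) simp
  next
    assume dag: "dag = transpose_mat"
    have "entry (mode_prod B i (dag V)) p = real_form n r (e p) (\<lambda>_ _. 0) V"
      if V: "V \<in> carrier_mat n r" and p: "p ! i < r" for V p
      using V p column[OF p, of "\<lambda>k j. V $$ (k, j)"]
      by (simp add: mode_prod_def real_form_def dag n)
    moreover have "dims (mode_prod B i (dag V)) = (dims B)[i := r]"
      if "V \<in> carrier_mat n r" for V
      using that by (simp add: mode_prod_def dag)
    ultimately show ?thesis
      unfolding real_linear_family_def using i
      by (intro exI[of _ "(dims B)[i := r]"] exI[of _ e] exI[of _ "\<lambda>_ _ _. 0"]) simp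
  qed
qed

lemma real_linear_family_mode_prod:
  assumes F: "real_linear_family n r i F" and m: "m \<noteq> i"
  shows "real_linear_family n r i (\<lambda>V. mode_prod (F V) m X)"
proof -
  obtain D b c where D: "i < length D" "D ! i = r"
    and dims: "\<And>V. V \<in> carrier_mat n r \<Longrightarrow> dims (F V) = D"
    and ent: "\<And>V p. V \<in> carrier_mat n r \<Longrightarrow> p ! i < r \<Longrightarrow>
      entry (F V) p = real_form n r (b p) (c p) V"
    using F unfolding real_linear_family_def by metis
  define combine where
    "combine e p k j = (\<Sum>q<D ! m. e (p[m := q]) k j * X $$ (p ! m, q))"
    for e :: "nat list \<Rightarrow> nat \<Rightarrow> nat \<Rightarrow> complex" and p k j
  have "entry (mode_prod (F V) m X) p = real_form n r (combine b p) (combine c p) V"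
    if V: "V \<in> carrier_mat n r" and p: "p ! i < r" for V p
  proof -
    have "entry (mode_prod (F V) m X) p
        = (\<Sum>q<D ! m. real_form n r (b (p[m := q])) (c (p[m := q])) V * X $$ (p ! m, q))"
      using V p m by (simp add: mode_prod_def dims ent)
    also have "\<dots> = real_form n r (combine b p) (combine c p) V"
      unfolding combine_def by (rule real_form_sum_coeffs) simp
    finally show ?thesis .
  qed
  then show ?thesis
    unfolding real_linear_family_def using D m dims
    by (intro exI[of _ "D[m := dim_row X]"] exI[of _ "combine b"] exI[of _ "combine c"])
      (simp add: mode_prod_def)
qed

lemma real_linear_family_fold:
  assumes "real_linear_family n r i F" "i \<notin> set ms"
  shows "real_linear_family n r i (\<lambda>V. fold (\<lambda>m B. mode_prod B m (Y m)) ms (F V))"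
  using assms
  by (induction ms arbitrary: F) (simp_all add: real_linear_family_mode_prod)

lemma dims_fold_mode_prod:
  "length (dims (fold (\<lambda>m B. mode_prod B m (Y m)) ms B)) = length (dims B)"
  "i \<notin> set ms \<Longrightarrow> dims (fold (\<lambda>m B. mode_prod B m (Y m)) ms B) ! i = dims B ! i"
  by (induction ms arbitrary: B) (simp_all add: mode_prod_def)

text \<open>Splitting the product at mode \<open>i\<close>: the modes before \<open>i\<close> produce a tensor without \<open>V\<close>, the
  product along \<open>i\<close> brings \<open>V\<close> in, and the modes after \<open>i\<close> preserve real-linearity.\<close>

lemma real_linear_family_multi_mode_prod:
  assumes dag: "dag = mat_adjoint \<or> dag = transpose_mat"
    and i: "i < length Us" and len: "length (dims B) = length Us" and n: "dims B ! i = n"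
  shows "real_linear_family n r i (\<lambda>V. multi_mode_prod B (map dag (Us[i := V])))"
proof -
  define Y where "Y m = dag (Us ! m)" for m
  define P where "P = fold (\<lambda>m B. mode_prod B m (Y m)) [0..<i] B"
  have P: "i < length (dims P)" "dims P ! i = n"
    using i len n by (simp_all add: P_def dims_fold_mode_prod)
  have split: "[0..<length Us] = [0..<i] @ i # [Suc i..<length Us]"
    using i upt_add_eq_append[of 0 i "length Us - i"] by (simp add: upt_conv_Cons)
  have "multi_mode_prod B (map dag (Us[i := V]))
      = fold (\<lambda>m B. mode_prod B m (Y m)) [Suc i..<length Us] (mode_prod P i (dag V))" for V
  proof -
    define Z where "Z m = map dag (Us[i := V]) ! m" for m
    have Z: "Z i = dag V" "\<And>m. m < length Us \<Longrightarrow> m \<noteq> i \<Longrightarrow> Z m = Y m"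
      using i by (simp_all add: Z_def Y_def)
    have "multi_mode_prod B (map dag (Us[i := V]))
        = fold (\<lambda>m B. mode_prod B m (Z m)) [Suc i..<length Us]
            (mode_prod (fold (\<lambda>m B. mode_prod B m (Z m)) [0..<i] B) i (Z i))"
      by (simp add: multi_mode_prod_def Z_def split)
    also have "fold (\<lambda>m B. mode_prod B m (Z m)) [0..<i] B = P"
      unfolding P_def by (rule List.fold_cong) (use i Z(2) in auto)
    also have "fold (\<lambda>m B. mode_prod B m (Z m)) [Suc i..<length Us] (mode_prod P i (Z i))
        = fold (\<lambda>m B. mode_prod B m (Y m)) [Suc i..<length Us] (mode_prod P i (Z i))"
      by (rule List.fold_cong) (use Z(2) in auto)
    finally show ?thesis by (simp add: Z)
  qed
  then show ?thesis
    using real_linear_family_fold[OF real_linear_family_start[OF dag P]] by simp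
qed

lemma real_linear_family_tnorm:
  assumes "real_linear_family n r i F"
  obtains D b c where "\<And>V. V \<in> carrier_mat n r \<Longrightarrow>
    (tnorm (F V))\<^sup>2 = (\<Sum>p\<in>multi_indices D. (cmod (real_form n r (b p) (c p) V))\<^sup>2)"
proof -
  obtain D b c where D: "i < length D" "D ! i = r"
    and dims: "\<And>V. V \<in> carrier_mat n r \<Longrightarrow> dims (F V) = D"
    and ent: "\<And>V p. V \<in> carrier_mat n r \<Longrightarrow> p ! i < r \<Longrightarrow>
      entry (F V) p = real_form n r (b p) (c p) V"
    using assms unfolding real_linear_family_def by metis
  have "(tnorm (F V))\<^sup>2 = (\<Sum>p\<in>multi_indices D. (cmod (real_form n r (b p) (c p) V))\<^sup>2)"
    if V: "V \<in> carrier_mat n r" for V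
  proof -
    have "(tnorm (F V))\<^sup>2 = (\<Sum>p\<in>multi_indices D. (cmod (entry (F V) p))\<^sup>2)"
      using V by (simp add: tnorm_def dims sum_nonneg)
    also have "\<dots> = (\<Sum>p\<in>multi_indices D. (cmod (real_form n r (b p) (c p) V))\<^sup>2)"
      using V D by (intro sum.cong refl) (auto simp: multi_indices_def ent)
    finally show ?thesis .
  qed
  then show thesis by (rule that)
qed

section \<open>The objective as a quadratic form in one block\<close>

text \<open>The squared Frobenius norm of each tensor sums over its own entries, so the index set of
  the quadratic form consists of the pairs of a tensor number and a multi-index.\<close>

lemma block_tucker_objective_quadratic:
  assumes dag: "dag = mat_adjoint \<or> dag = transpose_mat"
    and A: "\<And>l. l \<in> {1..L} \<Longrightarrow> dims (A l) = ns"
    and a: "\<And>l. l \<in> {1..L} \<Longrightarrow> 0 \<le> a l"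
    and i: "i < length ns" and Us: "length Us = length ns"
  shows "\<exists>(S :: (nat \<times> nat list) set) w b c. (\<forall>x\<in>S. 0 \<le> w x) \<and>
    (\<forall>V\<in>carrier_mat (ns ! i) r. block (tucker_objective dag L a A) Us i V
      = (\<Sum>x\<in>S. w x * (cmod (real_form (ns ! i) r (b x) (c x) V))\<^sup>2))"
proof -
  define P where "P l D b c \<longleftrightarrow> (\<forall>V\<in>carrier_mat (ns ! i) r.
      (tnorm (multi_mode_prod (A l) (map dag (Us[i := V]))))\<^sup>2
        = (\<Sum>p\<in>multi_indices D. (cmod (real_form (ns ! i) r (b p) (c p) V))\<^sup>2))" for l D b c
  have "\<exists>D b c. P l D b c" if l: "l \<in> {1..L}" for l
  proof -
    have "real_linear_family (ns ! i) r i (\<lambda>V. multi_mode_prod (A l) (map dag (Us[i := V])))"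
      using A[OF l] i Us by (intro real_linear_family_multi_mode_prod[OF dag]) simp_all
    then obtain D b c where "P l D b c"
      unfolding P_def by (rule real_linear_family_tnorm) blast
    then show ?thesis by blast
  qed
  then obtain D b c where "\<And>l. l \<in> {1..L} \<Longrightarrow> P l (D l) (b l) (c l)"
    by metis
  then have Dbc: "\<And>l V. l \<in> {1..L} \<Longrightarrow> V \<in> carrier_mat (ns ! i) r \<Longrightarrow>
      (tnorm (multi_mode_prod (A l) (map dag (Us[i := V]))))\<^sup>2
        = (\<Sum>p\<in>multi_indices (D l). (cmod (real_form (ns ! i) r (b l p) (c l p) V))\<^sup>2)"
    unfolding P_def by blast
  have "block (tucker_objective dag L a A) Us i V
      = (\<Sum>(l, p)\<in>Sigma {1..L} (\<lambda>l. multi_indices (D l)).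
          a l * (cmod (real_form (ns ! i) r (b l p) (c l p) V))\<^sup>2)"
    if V: "V \<in> carrier_mat (ns ! i) r" for V
  proof -
    have "block (tucker_objective dag L a A) Us i V
        = (\<Sum>l=1..L. \<Sum>p\<in>multi_indices (D l).
            a l * (cmod (real_form (ns ! i) r (b l p) (c l p) V))\<^sup>2)"
      unfolding block_def tucker_objective_def using V
      by (intro sum.cong refl) (simp add: Dbc sum_distrib_left)
    then show ?thesis by (simp add: sum.Sigma finite_multi_indices)
  qed
  moreover have "0 \<le> a (fst x)" if "x \<in> Sigma {1..L} (\<lambda>l. multi_indices (D l))" for x
    using that by (intro a) auto
  ultimately show ?thesis
    unfolding case_prod_beta
    by (intro exI[of _ "Sigma {1..L} (\<lambda>l. multi_indices (D l))"] exI[of _ "\<lambda>x. a (fst x)"]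
        exI[of _ "\<lambda>x. b (fst x) (snd x)"] exI[of _ "\<lambda>x. c (fst x) (snd x)"] conjI ballI)
qed

theorem proposition7p5:
  fixes d L :: nat and ns rs :: "nat list"
    and A :: "nat \<Rightarrow> ctensor" and a :: "nat \<Rightarrow> real"
    and dag :: "complex mat \<Rightarrow> complex mat"
  assumes "d > 1"
    and "length ns = d" and "length rs = d"
    and "\<And>i. i < d \<Longrightarrow> 1 \<le> rs ! i \<and> rs ! i \<le> ns ! i"
    and "\<And>l. l \<in> {1..L} \<Longrightarrow> dims (A l) = ns"
    and "\<And>l. l \<in> {1..L} \<Longrightarrow> 0 \<le> a l"
    and "dag = mat_adjoint \<or> dag = transpose_mat"
  shows "restricted_homogeneous rs ns (1/2) (tucker_objective dag L a A)
       \<and> block_multiconvex rs ns (tucker_objective dag L a A)"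
proof -
  define f where "f = tucker_objective dag L a A"
  have quadratic: "\<exists>(S :: (nat \<times> nat list) set) w b c. (\<forall>x\<in>S. 0 \<le> w x) \<and>
      (\<forall>V\<in>carrier_mat (ns ! i) (rs ! i). block f Us i V
        = (\<Sum>x\<in>S. w x * (cmod (real_form (ns ! i) (rs ! i) (b x) (c x) V))\<^sup>2))"
    if i: "i < length ns" and Us: "stiefel_blocks_except rs ns i Us" for i Us
    unfolding f_def
    by (rule block_tucker_objective_quadratic[OF assms(7,5,6) i])
      (use Us in \<open>simp_all add: stiefel_blocks_except_def\<close>)
  have "(\<exists>G. has_gradient (ns ! i) (rs ! i) (block f Us i) U G) \<and>
      block f Us i U = 1/2 * rinner U (gradient (ns ! i) (rs ! i) (block f Us i) U)"
    if i: "i < length ns" and Us: "stiefel_blocks_except rs ns i Us"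
      and U: "U \<in> stiefel (rs ! i) (ns ! i)" for i Us U
  proof -
    have U': "U \<in> carrier_mat (ns ! i) (rs ! i)" using U by (simp add: stiefel_def)
    obtain S :: "(nat \<times> nat list) set" and w b c where w: "\<forall>x\<in>S. 0 \<le> w x"
      and h: "\<forall>V\<in>carrier_mat (ns ! i) (rs ! i). block f Us i V
        = (\<Sum>x\<in>S. w x * (cmod (real_form (ns ! i) (rs ! i) (b x) (c x) V))\<^sup>2)"
      using quadratic[OF i Us] by blast
    obtain G where G: "has_gradient (ns ! i) (rs ! i) (block f Us i) U G"
      "block f Us i U = 1/2 * rinner U G"
      by (rule sum_cmod_real_form_has_gradient[OF bspec[OF h] bspec[OF w] U'])
    then show ?thesis using gradient_eq[OF G(1)] by auto
  qed
  moreover have "convex_on_mat (ns ! i) (rs ! i) (block f Us i)"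
    if i: "i < length ns" and Us: "stiefel_blocks_except rs ns i Us" for i Us
  proof -
    obtain S :: "(nat \<times> nat list) set" and w b c where w: "\<forall>x\<in>S. 0 \<le> w x"
      and h: "\<forall>V\<in>carrier_mat (ns ! i) (rs ! i). block f Us i V
        = (\<Sum>x\<in>S. w x * (cmod (real_form (ns ! i) (rs ! i) (b x) (c x) V))\<^sup>2)"
      using quadratic[OF i Us] by blast
    show ?thesis by (rule sum_cmod_real_form_convex[OF bspec[OF h] bspec[OF w]])
  qed
  ultimately show ?thesis
    unfolding restricted_homogeneous_def block_multiconvex_def f_def[symmetric] by simp
qed

end
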